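(* Let $\mathbb{G}$ be an infinite, connected, locally finite graph with basepoint $o\in V(\mathbb{G})$ such that $\imath_E^*(\mathbb{G})>0$. Consider $p$-Bernoulli bond percolation on $\mathbb{G}$ with $p\in[0,1]$ and let $\mathbb{H}$ be the open cluster containing $o$. If $p>1/(1+\imath_E^*(\mathbb{G}))$, then almost surely on the event that $\mathbb{H}$ is infinite, $\imath_E^*(\mathbb{H})>0$.
   Context: For a graph $G$ and $S\subset V(G)$, $|S|$ is the cardinality of $S$, and $\partial_G S$ (also written $\partial S$) is the set of edges of $G$ with one end in $S$ and the other in $S^c$. $S$ is called connected if the subgraph of $G$ induced on $S$ is connected. For an infinite connected graph $G$ with basepoint $o$, the anchored expansion constant is $$\imath_E^*(G):=\lim_{n\to\infty}\inf\left\{\frac{|\partial S|}{|S|}: o\in S\subset V(G),\ S\text{ is connected},\ n\le |S|<\infty\right\};$$ it does not depend on the choice of $o$. In $p$-Bernoulli bond percolation on $\mathbb{G}$, each edge of $\mathbb{G}$ is independently declared open with probability $p$ and closed with probability $1-p$; an open cluster is a connected component of the subgraph formed by the open edges, regarded as a graph whose edges are its open edges. The constant $\imath_E^*(\mathbb{H})$ is computed in the random graph $\mathbb{H}$. *)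

theory Defs
  imports "HOL-Probability.Probability"
begin

record 'v graph =
  verts :: "'v set"
  edges :: "'v set set"

definition simple_graph :: "'v graph \<Rightarrow> bool" where
  "simple_graph G \<longleftrightarrow> (\<forall>e\<in>edges G. e \<subseteq> verts G \<and> card e = 2)"

definition adjacency :: "'v graph \<Rightarrow> ('v \<times> 'v) set" where
  "adjacency G = {(u, v). {u, v} \<in> edges G}"

definition connected_graph :: "'v graph \<Rightarrow> bool" where
  "connected_graph G \<longleftrightarrow>
     verts G \<noteq> {} \<and> (\<forall>u\<in>verts G. \<forall>v\<in>verts G. (u, v) \<in> (adjacency G)\<^sup>*)"

definition locally_finite_graph :: "'v graph \<Rightarrow> bool" where
  "locally_finite_graph G \<longleftrightarrow> (\<forall>v\<in>verts G. finite {e \<in> edges G. v \<in> e})"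

definition induced_subgraph :: "'v graph \<Rightarrow> 'v set \<Rightarrow> 'v graph" where
  "induced_subgraph G S = \<lparr>verts = S, edges = {e \<in> edges G. e \<subseteq> S}\<rparr>"

definition edge_boundary :: "'v graph \<Rightarrow> 'v set \<Rightarrow> 'v set set" where
  "edge_boundary G S = {e \<in> edges G. \<exists>u\<in>S. \<exists>v\<in>verts G - S. e = {u, v}}"

definition anchored_sets :: "'v graph \<Rightarrow> 'v \<Rightarrow> nat \<Rightarrow> 'v set set" where
  "anchored_sets G x n =
     {S. x \<in> S \<and> S \<subseteq> verts G \<and> connected_graph (induced_subgraph G S) \<and> finite S \<and> n \<le> card S}"

text \<open>The values are extended reals because the limit can be infinite when the degrees are
  unbounded. In a locally finite graph the edge boundary of a finite set is finite, so its
  \<open>card\<close> is the true cardinality.\<close>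

definition anchored_expansion :: "'v graph \<Rightarrow> 'v \<Rightarrow> ereal" where
  "anchored_expansion G x =
     lim (\<lambda>n. INF S\<in>anchored_sets G x n. ereal (real (card (edge_boundary G S)) / real (card S)))"

lemma anchored_expansion_LIMSEQ:
  "(\<lambda>n. INF S\<in>anchored_sets G x n. ereal (real (card (edge_boundary G S)) / real (card S)))
     \<longlonglongrightarrow> anchored_expansion G x"
proof -
  let ?f = "\<lambda>n. INF S\<in>anchored_sets G x n.
    ereal (real (card (edge_boundary G S)) / real (card S))"
  have "incseq ?f"
  proof (rule incseq_SucI)
    fix n
    have "anchored_sets G x (Suc n) \<subseteq> anchored_sets G x n"
      unfolding anchored_sets_def by (blast intro: Suc_leD)
    then show "?f n \<le> ?f (Suc n)"
      by (rule INF_superset_mono) (rule order_refl)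
  qed
  then have "?f \<longlonglongrightarrow> (SUP n. ?f n)"
    by (rule LIMSEQ_SUP)
  then show ?thesis
    unfolding anchored_expansion_def by (simp only: limI)
qed

text \<open>A configuration maps each edge to \<open>True\<close> if it is open and to \<open>False\<close> if it is closed.\<close>

definition bernoulli_percolation :: "'v graph \<Rightarrow> real \<Rightarrow> ('v set \<Rightarrow> bool) measure" where
  "bernoulli_percolation G p = PiM (edges G) (\<lambda>_. measure_pmf (bernoulli_pmf p))"

definition open_subgraph :: "'v graph \<Rightarrow> ('v set \<Rightarrow> bool) \<Rightarrow> 'v graph" where
  "open_subgraph G \<omega> = \<lparr>verts = verts G, edges = {e \<in> edges G. \<omega> e}\<rparr>"

definition open_cluster :: "'v graph \<Rightarrow> ('v set \<Rightarrow> bool) \<Rightarrow> 'v \<Rightarrow> 'v graph" where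
  "open_cluster G \<omega> x =
     induced_subgraph (open_subgraph G \<omega>)
       {y \<in> verts G. (x, y) \<in> (adjacency (open_subgraph G \<omega>))\<^sup>*}"

end

theory Submission
  imports Defs
begin

text \<open>
  Write \<open>b\<close> for the number of boundary edges in \<open>G\<close> of a finite connected set \<open>S\<close> containing the
  base point \<open>x\<close>, and \<open>n\<close> for its size. Choose \<open>h > 0\<close> below the anchored expansion constant of \<open>G\<close>
  such that \<open>p' = 1 / (1 + h) < p\<close>. All sufficiently large \<open>S\<close> satisfy \<open>h * n \<le> b\<close>. Call such a set
  bad if the open edges inside \<open>S\<close> connect it and at most \<open>\<epsilon> * n\<close> of its boundary edges are open.
  If only finitely many sets are bad, then every large anchored set of the open cluster has more than
  \<open>\<epsilon> * n\<close> boundary edges in the cluster, so the cluster has anchored expansion at least \<open>\<epsilon>\<close>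
  (\<open>anchored_expansion_open_cluster_ge\<close>). By the Borel--Cantelli lemma it therefore suffices that the
  probabilities of being bad have a finite sum over \<open>S\<close>.

  The sum is bounded by comparing the two parameters \<open>p\<close> and \<open>p'\<close>: for suitable \<open>\<epsilon>\<close>, the probability
  at \<open>p\<close> that \<open>S\<close> is bad is at most the probability at \<open>p'\<close> that the open cluster of \<open>x\<close> is exactly
  \<open>S\<close> (\<open>measure_thin_event_le\<close>). The latter events are disjoint for distinct \<open>S\<close>, so their
  probabilities sum to at most 1. The comparison has three ingredients.

  Thinning: keeping each open edge of a \<open>p\<close>-configuration with probability \<open>p' / p\<close> gives a
  \<open>p'\<close>-configuration, and a connected \<open>S\<close> stays connected if a spanning tree survives. Hence the
  probability \<open>q p\<close> that \<open>S\<close> is internally connected satisfies \<open>q p \<le> (p / p') ^ n * q p'\<close>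
  (\<open>bernoulli_sum_increasing_compare\<close>).

  Chernoff's bound: for \<open>0 < s \<le> 1\<close>, at most \<open>\<epsilon> * n\<close> boundary edges are open with probability
  at most \<open>(1 - p + p * s) ^ b * s powr (- (\<epsilon> * n))\<close> (\<open>bernoulli_sum_card_le\<close>).

  Calculus: the function \<open>u powr (1 / h) * (1 - u)\<close> of \<open>u \<in> [0, 1]\<close> attains its maximum only at
  \<open>u = p'\<close>. So \<open>(p / p') ^ n * (1 - p) ^ b\<close> is smaller than \<open>(1 - p') ^ b\<close> by a factor that
  is exponentially small in \<open>n\<close> when \<open>h * n \<le> b\<close>, and this leaves room for some \<open>s\<close> and \<open>\<epsilon>\<close>
  (\<open>percolation_constants\<close>).
\<close>

section \<open>Bernoulli averages over subsets of a finite set\<close>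

text \<open>The expectation of \<open>g A\<close>, where \<open>A\<close> is the random subset of the finite set \<open>F\<close> that contains
  each element independently with probability \<open>p\<close>.\<close>

definition bernoulli_sum :: "real \<Rightarrow> 'a set \<Rightarrow> ('a set \<Rightarrow> real) \<Rightarrow> real" where
  "bernoulli_sum p F g = (\<Sum>A\<in>Pow F. p ^ card A * (1 - p) ^ card (F - A) * g A)"

lemma sum_Pow_Un_disjoint:
  assumes "I \<inter> J = {}"
  shows "(\<Sum>C\<in>Pow (I \<union> J). f C) = (\<Sum>A\<in>Pow I. \<Sum>B\<in>Pow J. f (A \<union> B))"
proof -
  have "bij_betw (\<lambda>(A, B). A \<union> B) (Pow I \<times> Pow J) (Pow (I \<union> J))"
    by (rule bij_betw_byWitness[where f' = "\<lambda>C. (C \<inter> I, C \<inter> J)"]) (use assms in auto)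
  then have "(\<Sum>C\<in>Pow (I \<union> J). f C) = (\<Sum>(A, B)\<in>Pow I \<times> Pow J. f (A \<union> B))"
    by (subst sum.reindex_bij_betw[symmetric, where h = "\<lambda>(A, B). A \<union> B"])
      (auto simp: case_prod_beta)
  then show ?thesis
    by (simp add: sum.cartesian_product)
qed

lemma bernoulli_sum_Un_disjoint:
  assumes "finite I" "finite J" "I \<inter> J = {}"
  shows "bernoulli_sum p (I \<union> J) (\<lambda>A. g (A \<inter> I) * k (A \<inter> J)) = bernoulli_sum p I g * bernoulli_sum p J k"
proof -
  have *: "p ^ card (A \<union> B) * (1 - p) ^ card (I \<union> J - (A \<union> B)) * (g ((A \<union> B) \<inter> I) * k ((A \<union> B) \<inter> J)) =
     (p ^ card A * (1 - p) ^ card (I - A) * g A) * (p ^ card B * (1 - p) ^ card (J - B) * k B)"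
    if "A \<in> Pow I" "B \<in> Pow J" for A B
  proof -
    have fin: "finite A" "finite B"
      using that assms by (auto intro: finite_subset)
    have eqs: "(A \<union> B) \<inter> I = A" "(A \<union> B) \<inter> J = B" "I \<union> J - (A \<union> B) = (I - A) \<union> (J - B)"
      using that assms by auto
    have c1: "card (A \<union> B) = card A + card B"
      using that assms fin by (intro card_Un_disjoint) auto
    have c2: "card ((I - A) \<union> (J - B)) = card (I - A) + card (J - B)"
      using that assms fin by (intro card_Un_disjoint) auto
    show ?thesis
      unfolding eqs c1 c2 by (simp add: power_add algebra_simps)
  qed
  show ?thesis
    unfolding bernoulli_sum_def sum_Pow_Un_disjoint[OF assms(3)] sum_product
    by (intro sum.cong refl) (use * in auto)
qed

lemma sum_Pow_power:
  fixes a b :: real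
  assumes "finite F"
  shows "(\<Sum>A\<in>Pow F. a ^ card A * b ^ card (F - A)) = (a + b) ^ card F"
  using prod_add[OF assms, of "\<lambda>_. a" "\<lambda>_. b"] by simp

lemma bernoulli_sum_power_card:
  assumes "finite F"
  shows "bernoulli_sum p F (\<lambda>A. s ^ card A) = (1 - p + p * s) ^ card F"
proof -
  have "bernoulli_sum p F (\<lambda>A. s ^ card A) = (\<Sum>A\<in>Pow F. (p * s) ^ card A * (1 - p) ^ card (F - A))"
    unfolding bernoulli_sum_def by (intro sum.cong) (auto simp: power_mult_distrib)
  then show ?thesis
    using sum_Pow_power[OF assms, of "p * s" "1 - p"] by (simp add: algebra_simps)
qed

lemma bernoulli_sum_mono:
  assumes "0 \<le> p" "p \<le> 1" "\<And>A. A \<subseteq> F \<Longrightarrow> g A \<le> k A"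
  shows "bernoulli_sum p F g \<le> bernoulli_sum p F k"
  unfolding bernoulli_sum_def using assms by (intro sum_mono mult_left_mono) auto

lemma bernoulli_sum_nonneg:
  assumes "0 \<le> p" "p \<le> 1" "\<And>A. A \<subseteq> F \<Longrightarrow> 0 \<le> g A"
  shows "0 \<le> bernoulli_sum p F g"
  unfolding bernoulli_sum_def using assms by (intro sum_nonneg mult_nonneg_nonneg) auto

lemma bernoulli_sum_mult_right:
  "bernoulli_sum p F (\<lambda>A. g A * c) = bernoulli_sum p F g * c"
  unfolding bernoulli_sum_def by (simp add: sum_distrib_right mult.assoc)

text \<open>Choosing a random subset with density \<open>p\<close> and then keeping each of its elements with probability
  \<open>r\<close> is the same as choosing a random subset with density \<open>p * r\<close>.\<close>

lemma bernoulli_sum_thinning: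
  assumes "finite F"
  shows "bernoulli_sum (p * r) F g = bernoulli_sum p F (\<lambda>A. bernoulli_sum r A g)"
proof -
  have fin: "finite (Pow F)" "\<And>A. A \<in> Pow F \<Longrightarrow> finite {B \<in> Pow F. B \<subseteq> A}"
    using assms by auto
  have "bernoulli_sum p F (\<lambda>A. bernoulli_sum r A g) =
    (\<Sum>A\<in>Pow F. \<Sum>B\<in>{B \<in> Pow F. B \<subseteq> A}.
      p ^ card A * (1 - p) ^ card (F - A) * (r ^ card B * (1 - r) ^ card (A - B) * g B))"
    unfolding bernoulli_sum_def sum_distrib_left
    by (intro sum.cong refl) auto
  also have "\<dots> = (\<Sum>B\<in>Pow F. \<Sum>A\<in>{A \<in> Pow F. B \<subseteq> A}.
      p ^ card A * (1 - p) ^ card (F - A) * (r ^ card B * (1 - r) ^ card (A - B) * g B))"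
    by (rule sum.swap_restrict) (use fin in auto)
  also have "\<dots> = (\<Sum>B\<in>Pow F. (p * r) ^ card B * (1 - p * r) ^ card (F - B) * g B)"
  proof (intro sum.cong refl)
    fix B assume "B \<in> Pow F"
    then have B: "B \<subseteq> F" "finite B"
      using assms by (auto intro: finite_subset)
    have "bij_betw (\<lambda>C. B \<union> C) (Pow (F - B)) {A \<in> Pow F. B \<subseteq> A}"
      by (rule bij_betw_byWitness[where f' = "\<lambda>A. A - B"]) (use B in auto)
    then have "(\<Sum>A\<in>{A \<in> Pow F. B \<subseteq> A}.
      p ^ card A * (1 - p) ^ card (F - A) * (r ^ card B * (1 - r) ^ card (A - B) * g B)) =
      (\<Sum>C\<in>Pow (F - B). p ^ card (B \<union> C) * (1 - p) ^ card (F - (B \<union> C)) *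
        (r ^ card B * (1 - r) ^ card (B \<union> C - B) * g B))"
      by (rule sum.reindex_bij_betw[symmetric])
    \<comment> \<open>For fixed \<open>B\<close>, each element outside \<open>B\<close> is chosen and then deleted, or not chosen at all.\<close>
    also have "\<dots> = (\<Sum>C\<in>Pow (F - B). ((p * r) ^ card B * g B) *
        ((p * (1 - r)) ^ card C * (1 - p) ^ card (F - B - C)))"
    proof (intro sum.cong refl)
      fix C assume C: "C \<in> Pow (F - B)"
      then have "finite C"
        using assms by (auto intro: finite_subset)
      then have "card (B \<union> C) = card B + card C"
        using B C by (intro card_Un_disjoint) auto
      moreover have "B \<union> C - B = C" "F - (B \<union> C) = F - B - C"
        using C by auto
      ultimately show "p ^ card (B \<union> C) * (1 - p) ^ card (F - (B \<union> C)) *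
        (r ^ card B * (1 - r) ^ card (B \<union> C - B) * g B) =
        ((p * r) ^ card B * g B) * ((p * (1 - r)) ^ card C * (1 - p) ^ card (F - B - C))"
        by (simp add: power_add power_mult_distrib)
    qed
    also have "\<dots> = (p * r) ^ card B * g B * (p * (1 - r) + (1 - p)) ^ card (F - B)"
      using assms by (simp add: sum_distrib_left[symmetric] sum_Pow_power)
    also have "p * (1 - r) + (1 - p) = 1 - p * r"
      by (simp add: algebra_simps)
    finally show "(\<Sum>A\<in>{A \<in> Pow F. B \<subseteq> A}.
      p ^ card A * (1 - p) ^ card (F - A) * (r ^ card B * (1 - r) ^ card (A - B) * g B)) =
      (p * r) ^ card B * (1 - p * r) ^ card (F - B) * g B"
      by (simp add: algebra_simps)
  qed
  finally show ?thesis
    by (simp add: bernoulli_sum_def)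
qed

lemma bernoulli_sum_superset:
  assumes "finite F" "T \<subseteq> F"
  shows "bernoulli_sum p F (\<lambda>A. of_bool (T \<subseteq> A)) = p ^ card T"
proof -
  have T: "finite T" "F = T \<union> (F - T)"
    using assms by (auto intro: finite_subset)
  have "bernoulli_sum p (T \<union> (F - T)) (\<lambda>A. of_bool (T \<subseteq> A)) =
      bernoulli_sum p (T \<union> (F - T)) (\<lambda>A. of_bool (T \<subseteq> A \<inter> T) * 1 ^ card (A \<inter> (F - T)))"
    by simp
  also have "\<dots> = bernoulli_sum p T (\<lambda>A. of_bool (T \<subseteq> A)) * bernoulli_sum p (F - T) (\<lambda>A. 1 ^ card A)"
    by (rule bernoulli_sum_Un_disjoint) (use assms T in auto)
  also have "bernoulli_sum p (F - T) (\<lambda>A. 1 ^ card A) = 1"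
    using assms by (subst bernoulli_sum_power_card) auto
  also have "bernoulli_sum p T (\<lambda>A. of_bool (T \<subseteq> A)) = (\<Sum>A\<in>{T}. p ^ card A * (1 - p) ^ card (T - A))"
    unfolding bernoulli_sum_def using T(1) by (intro sum.mono_neutral_cong_right) auto
  finally show ?thesis
    using T by simp
qed

text \<open>If an increasing event always has a witness of at most \<open>n\<close> elements, then it survives thinning
  with probability at least \<open>r ^ n\<close>, because the whole witness survives with this probability.\<close>

lemma bernoulli_sum_increasing_compare:
  assumes "finite F" "0 \<le> p" "p \<le> 1" "0 \<le> r" "r \<le> 1"
    and mono: "\<And>A B. P A \<Longrightarrow> A \<subseteq> B \<Longrightarrow> B \<subseteq> F \<Longrightarrow> P B"
    and witness: "\<And>A. A \<subseteq> F \<Longrightarrow> P A \<Longrightarrow> \<exists>T\<subseteq>A. card T \<le> n \<and> P T"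
  shows "r ^ n * bernoulli_sum p F (\<lambda>A. of_bool (P A)) \<le> bernoulli_sum (p * r) F (\<lambda>A. of_bool (P A))"
proof -
  have "of_bool (P A) * r ^ n \<le> bernoulli_sum r A (\<lambda>B. of_bool (P B))" if A: "A \<subseteq> F" for A
  proof (cases "P A")
    case True
    then obtain T where T: "T \<subseteq> A" "card T \<le> n" "P T"
      using witness A by blast
    have "finite A"
      using A assms by (auto intro: finite_subset)
    have "r ^ n \<le> r ^ card T"
      using T assms by (intro power_decreasing) auto
    also have "\<dots> = bernoulli_sum r A (\<lambda>B. of_bool (T \<subseteq> B))"
      using \<open>finite A\<close> T by (simp add: bernoulli_sum_superset)
    also have "\<dots> \<le> bernoulli_sum r A (\<lambda>B. of_bool (P B))"
    proof (intro bernoulli_sum_mono)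
      show "of_bool (T \<subseteq> B) \<le> (of_bool (P B) :: real)" if "B \<subseteq> A" for B
        using mono[OF T(3), of B] that A by auto
    qed (use assms in auto)
    finally show ?thesis
      using True by simp
  next
    case False
    then show ?thesis
      using assms by (auto intro: bernoulli_sum_nonneg)
  qed
  then have "bernoulli_sum p F (\<lambda>A. of_bool (P A) * r ^ n) \<le>
      bernoulli_sum p F (\<lambda>A. bernoulli_sum r A (\<lambda>B. of_bool (P B)))"
    using assms by (intro bernoulli_sum_mono) auto
  then show ?thesis
    unfolding bernoulli_sum_mult_right bernoulli_sum_thinning[OF assms(1)] by (simp only: mult.commute)
qed

section \<open>Finite connected graphs\<close>

lemma adjacency_simps [simp]: "(u, v) \<in> adjacency G \<longleftrightarrow> {u, v} \<in> edges G"
  by (simp add: adjacency_def)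

lemma sym_adjacency_rtrancl: "sym ((adjacency G)\<^sup>*)"
  by (intro sym_rtrancl) (auto simp: sym_def insert_commute)

lemma connected_graph_iff_from:
  assumes "x \<in> verts G"
  shows "connected_graph G \<longleftrightarrow> (\<forall>v\<in>verts G. (x, v) \<in> (adjacency G)\<^sup>*)"
proof
  assume *: "\<forall>v\<in>verts G. (x, v) \<in> (adjacency G)\<^sup>*"
  have "(u, v) \<in> (adjacency G)\<^sup>*" if "u \<in> verts G" "v \<in> verts G" for u v
    using rtrancl_trans[OF symD[OF sym_adjacency_rtrancl]] * that by metis
  then show "connected_graph G"
    using assms by (auto simp: connected_graph_def)
qed (use assms in \<open>auto simp: connected_graph_def\<close>)

lemma connected_graph_mono:
  assumes "connected_graph \<lparr>verts = S, edges = A\<rparr>" "A \<subseteq> B"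
  shows "connected_graph \<lparr>verts = S, edges = B\<rparr>"
proof -
  have "adjacency \<lparr>verts = S, edges = A\<rparr> \<subseteq> adjacency \<lparr>verts = S, edges = B\<rparr>"
    using assms by (auto simp: adjacency_def)
  from rtrancl_mono[OF this] show ?thesis
    using assms(1) unfolding connected_graph_def graph.select_convs by blast
qed

text \<open>A breadth-first search tree, as a set of edges. The true bound \<open>card S - 1\<close> on the number of
  edges is relaxed to \<open>card S\<close>.\<close>

lemma connected_graph_spanning_subset:
  assumes conn: "connected_graph \<lparr>verts = S, edges = A\<rparr>" and "finite S" "A \<subseteq> Pow S"
  shows "\<exists>T\<subseteq>A. card T \<le> card S \<and> connected_graph \<lparr>verts = S, edges = T\<rparr>"
proof -
  obtain x where x: "x \<in> S"
    using conn by (auto simp: connected_graph_def)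
  define R where "R = adjacency \<lparr>verts = S, edges = A\<rparr>"
  define d where "d v = (LEAST k. (x, v) \<in> R ^^ k)" for v
  have reach: "(x, v) \<in> R ^^ d v" if "v \<in> S" for v
  proof -
    have "(x, v) \<in> R\<^sup>*"
      using conn x that by (auto simp: connected_graph_def R_def)
    then show ?thesis
      unfolding d_def by (metis LeastI rtrancl_imp_relpow)
  qed
  have "\<exists>u\<in>S. {u, v} \<in> A \<and> d u < d v" if v: "v \<in> S" "v \<noteq> x" for v
  proof -
    obtain k where k: "d v = Suc k"
      using reach[OF v(1)] v(2) by (cases "d v") auto
    then obtain u where u: "(x, u) \<in> R ^^ k" "(u, v) \<in> R"
      using reach[OF v(1)] by auto
    have "d u \<le> k"
      unfolding d_def by (rule Least_le) (rule u)
    then show ?thesis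
      using u k assms(3) by (intro bexI[of _ u]) (auto simp: R_def)
  qed
  then obtain par where par: "\<And>v. v \<in> S \<Longrightarrow> v \<noteq> x \<Longrightarrow> par v \<in> S \<and> {par v, v} \<in> A \<and> d (par v) < d v"
    by metis
  define T where "T = (\<lambda>v. {par v, v}) ` (S - {x})"
  have "(x, v) \<in> (adjacency \<lparr>verts = S, edges = T\<rparr>)\<^sup>*" if "v \<in> S" for v
    using that
  proof (induction "d v" arbitrary: v rule: less_induct)
    case less
    show ?case
    proof (cases "v = x")
      case False
      have "(par v, v) \<in> adjacency \<lparr>verts = S, edges = T\<rparr>"
        using False less.prems by (auto simp: T_def)
      moreover have "(x, par v) \<in> (adjacency \<lparr>verts = S, edges = T\<rparr>)\<^sup>*"
        using less par False by blast
      ultimately show ?thesis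
        by (rule rtrancl_into_rtrancl[rotated])
    qed simp
  qed
  then have "connected_graph \<lparr>verts = S, edges = T\<rparr>"
    using x by (subst connected_graph_iff_from[of x]) auto
  moreover have "card T \<le> card S"
    unfolding T_def using assms(2)
    by (meson Diff_subset card_image_le card_mono finite_Diff order_trans)
  moreover have "T \<subseteq> A"
    using par by (auto simp: T_def)
  ultimately show ?thesis
    by blast
qed

section \<open>Percolation events that depend on finitely many edges\<close>

lemma prob_space_bernoulli_percolation: "prob_space (bernoulli_percolation G p)"
  unfolding bernoulli_percolation_def by (intro prob_space_PiM prob_space_measure_pmf)

lemma space_bernoulli_percolation:
  "space (bernoulli_percolation G p) = (\<Pi>\<^sub>E e\<in>edges G. UNIV)"
  by (simp add: bernoulli_percolation_def space_PiM)

lemma bernoulli_percolation_finite_event: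
  assumes "finite F" "F \<subseteq> edges G" "0 \<le> p" "p \<le> 1"
  defines "M \<equiv> bernoulli_percolation G p"
  shows "{\<omega> \<in> space M. P {e \<in> F. \<omega> e}} \<in> sets M" (is "?E \<in> _")
    and "measure M {\<omega> \<in> space M. P {e \<in> F. \<omega> e}} = bernoulli_sum p F (\<lambda>A. of_bool (P A))"
proof -
  interpret product_prob_space "\<lambda>_. measure_pmf (bernoulli_pmf p)" "edges G"
    by unfold_locales
  interpret M: prob_space M
    unfolding M_def by (rule prob_space_bernoulli_percolation)
  define C where "C A = {\<omega> \<in> space M. {e \<in> F. \<omega> e} = A}" for A
  have C_emb: "C A = prod_emb (edges G) (\<lambda>_. measure_pmf (bernoulli_pmf p)) F (\<Pi>\<^sub>E e\<in>F. {e \<in> A})"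
    if "A \<subseteq> F" for A
    unfolding C_def M_def space_bernoulli_percolation prod_emb_def
    using that assms(2) by (auto simp: PiE_iff extensional_def restrict_def)
  have C_sets: "C A \<in> sets M" if "A \<subseteq> F" for A
    unfolding C_emb[OF that] M_def bernoulli_percolation_def
    using assms by (intro sets_PiM_I) auto
  have C_measure: "measure M (C A) = p ^ card A * (1 - p) ^ card (F - A)" if "A \<subseteq> F" for A
  proof -
    have "measure M (C A) = (\<Prod>e\<in>F. measure (measure_pmf (bernoulli_pmf p)) {e \<in> A})"
      unfolding C_emb[OF that] M_def bernoulli_percolation_def
      using assms by (intro measure_PiM_emb) auto
    also have "\<dots> = (\<Prod>e\<in>F. if e \<in> A then p else 1 - p)"
      using assms by (intro prod.cong) (auto simp: measure_pmf_single)
    also have "\<dots> = (\<Prod>e\<in>A. p) * (\<Prod>e\<in>F - A. 1 - p)"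
      using that assms(1) by (subst prod.If_cases) (auto simp: Int_absorb1 Diff_eq)
    finally show ?thesis
      by simp
  qed
  have E: "?E = (\<Union>A\<in>{A \<in> Pow F. P A}. C A)"
    by (auto simp: C_def)
  show "?E \<in> sets M"
    unfolding E using assms(1) C_sets by (intro sets.finite_UN) auto
  have "measure M ?E = (\<Sum>A\<in>{A \<in> Pow F. P A}. measure M (C A))"
    unfolding E using assms(1) C_sets
    by (intro M.finite_measure_finite_Union) (auto simp: disjoint_family_on_def C_def)
  also have "\<dots> = bernoulli_sum p F (\<lambda>A. of_bool (P A))"
    unfolding bernoulli_sum_def using assms(1) C_measure
    by (intro sum.mono_neutral_cong_left) auto
  finally show "measure M ?E = bernoulli_sum p F (\<lambda>A. of_bool (P A))" .
qed


section \<open>Edges inside and on the boundary of a finite vertex set\<close>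

text \<open>The edges of the subgraph induced on \<open>S\<close>.\<close>

definition internal_edges :: "'v graph \<Rightarrow> 'v set \<Rightarrow> 'v set set" where
  "internal_edges G S = {e \<in> edges G. e \<subseteq> S}"

lemma finite_internal_edges: "finite S \<Longrightarrow> finite (internal_edges G S)"
  by (rule finite_subset[of _ "Pow S"]) (auto simp: internal_edges_def)

lemma finite_edge_boundary:
  assumes "locally_finite_graph G" "finite S" "S \<subseteq> verts G"
  shows "finite (edge_boundary G S)"
proof (rule finite_subset)
  show "edge_boundary G S \<subseteq> (\<Union>v\<in>S. {e \<in> edges G. v \<in> e})"
    by (auto simp: edge_boundary_def)
  show "finite (\<Union>v\<in>S. {e \<in> edges G. v \<in> e})"
    using assms by (auto simp: locally_finite_graph_def)
qed

lemma internal_edges_Int_edge_boundary: "internal_edges G S \<inter> edge_boundary G S = {}"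
  by (auto simp: internal_edges_def edge_boundary_def)

lemma countable_verts:
  assumes "simple_graph G" "connected_graph G" "locally_finite_graph G"
  shows "countable (verts G)"
proof -
  obtain x where x: "x \<in> verts G"
    using assms(2) by (auto simp: connected_graph_def)
  define R where "R = adjacency G"
  have fin_nbrs: "finite (R `` {v})" for v
  proof (cases "v \<in> verts G")
    case True
    then have "finite {e \<in> edges G. v \<in> e}"
      using assms(3) by (auto simp: locally_finite_graph_def)
    moreover have "(\<lambda>w. {v, w}) ` (R `` {v}) \<subseteq> {e \<in> edges G. v \<in> e}"
      by (auto simp: R_def)
    ultimately have "finite ((\<lambda>w. {v, w}) ` (R `` {v}))"
      by (rule finite_subset[rotated])
    then show ?thesis
      by (rule finite_imageD) (auto simp: inj_on_def doubleton_eq_iff)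
  next
    case False
    then have "R `` {v} = {}"
      using assms(1) unfolding R_def simple_graph_def by fastforce
    then show ?thesis
      by simp
  qed
  have "finite ((R ^^ n) `` {x})" for n
  proof (induction n)
    case (Suc n)
    have "(R ^^ Suc n) `` {x} = (\<Union>v\<in>(R ^^ n) `` {x}. R `` {v})"
      by auto
    then show ?case
      using Suc fin_nbrs by simp
  qed simp
  then have "countable (\<Union>n. (R ^^ n) `` {x})"
    by (auto intro: countable_finite)
  moreover have "verts G \<subseteq> (\<Union>n. (R ^^ n) `` {x})"
  proof
    fix v assume "v \<in> verts G"
    then have "(x, v) \<in> R\<^sup>*"
      using assms(2) x by (auto simp: connected_graph_def R_def)
    then show "v \<in> (\<Union>n. (R ^^ n) `` {x})"
      by (auto dest: rtrancl_imp_relpow)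
  qed
  ultimately show ?thesis
    by (rule countable_subset[rotated])
qed

section \<open>Open clusters with few open boundary edges\<close>

text \<open>The event that the open edges inside \<open>S\<close> connect \<open>S\<close> and that at most \<open>\<epsilon> * card S\<close> boundary
  edges of \<open>S\<close> are open. For \<open>\<epsilon> = 0\<close> and a finite boundary it says that
  \<open>S\<close> is an open cluster. The product space does
  not depend on \<open>p\<close>, so the same set serves for all parameters.\<close>

definition thin_event :: "'v graph \<Rightarrow> real \<Rightarrow> 'v set \<Rightarrow> ('v set \<Rightarrow> bool) set" where
  "thin_event G \<epsilon> S =
     {\<omega> \<in> \<Pi>\<^sub>E e\<in>edges G. UNIV.
        connected_graph \<lparr>verts = S, edges = {e \<in> internal_edges G S. \<omega> e}\<rparr> \<and>
        real (card {e \<in> edge_boundary G S. \<omega> e}) \<le> \<epsilon> * real (card S)}"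

lemma
  assumes G: "locally_finite_graph G" and S: "finite S" "S \<subseteq> verts G" and p: "0 \<le> p" "p \<le> 1"
  shows thin_event_sets: "thin_event G \<epsilon> S \<in> sets (bernoulli_percolation G p)"
    and measure_thin_event: "measure (bernoulli_percolation G p) (thin_event G \<epsilon> S) =
      bernoulli_sum p (internal_edges G S)
        (\<lambda>A. of_bool (connected_graph \<lparr>verts = S, edges = A\<rparr>)) *
      bernoulli_sum p (edge_boundary G S) (\<lambda>A. of_bool (real (card A) \<le> \<epsilon> * real (card S)))"
proof -
  let ?I = "internal_edges G S" and ?J = "edge_boundary G S"
  let ?P = "\<lambda>A. connected_graph \<lparr>verts = S, edges = A\<rparr>"
  let ?Q = "\<lambda>A :: 'a set set. real (card A) \<le> \<epsilon> * real (card S)"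
  have fin: "finite ?I" "finite ?J"
    using G S by (auto intro: finite_internal_edges finite_edge_boundary)
  have sub: "?I \<union> ?J \<subseteq> edges G"
    by (auto simp: internal_edges_def edge_boundary_def)
  have "{e \<in> ?I \<union> ?J. \<omega> e} \<inter> ?I = {e \<in> ?I. \<omega> e}" "{e \<in> ?I \<union> ?J. \<omega> e} \<inter> ?J = {e \<in> ?J. \<omega> e}" for \<omega>
    by auto
  then have eq: "thin_event G \<epsilon> S = {\<omega> \<in> space (bernoulli_percolation G p).
      (\<lambda>A. ?P (A \<inter> ?I) \<and> ?Q (A \<inter> ?J)) {e \<in> ?I \<union> ?J. \<omega> e}}"
    by (simp add: thin_event_def space_bernoulli_percolation)
  show "thin_event G \<epsilon> S \<in> sets (bernoulli_percolation G p)"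
    unfolding eq using fin sub p by (intro bernoulli_percolation_finite_event) auto
  have "measure (bernoulli_percolation G p) (thin_event G \<epsilon> S) =
      bernoulli_sum p (?I \<union> ?J) (\<lambda>A. of_bool (?P (A \<inter> ?I) \<and> ?Q (A \<inter> ?J)))"
    unfolding eq using fin sub p by (intro bernoulli_percolation_finite_event) auto
  also have "\<dots> = bernoulli_sum p ?I (\<lambda>A. of_bool (?P A)) * bernoulli_sum p ?J (\<lambda>A. of_bool (?Q A))"
    unfolding of_bool_conj
    using fin internal_edges_Int_edge_boundary by (rule bernoulli_sum_Un_disjoint)
  finally show "measure (bernoulli_percolation G p) (thin_event G \<epsilon> S) =
      bernoulli_sum p ?I (\<lambda>A. of_bool (?P A)) * bernoulli_sum p ?J (\<lambda>A. of_bool (?Q A))" .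
qed

lemma bernoulli_sum_card_le:
  assumes "finite F" "0 \<le> p" "p \<le> 1" "0 < s" "s \<le> 1"
  shows "bernoulli_sum p F (\<lambda>A. of_bool (real (card A) \<le> c)) \<le> (1 - p + p * s) ^ card F * s powr (- c)"
proof -
  have "of_bool (real (card A) \<le> c) \<le> s ^ card A * s powr (- c)" for A :: "'a set"
  proof (cases "real (card A) \<le> c")
    case True
    have "1 = s powr 0"
      using assms by simp
    also have "\<dots> \<le> s powr (real (card A) - c)"
      using True assms by (intro powr_mono') auto
    also have "\<dots> = s ^ card A * s powr (- c)"
      using assms by (simp add: powr_diff powr_realpow powr_minus_divide)
    finally show ?thesis
      using True by simp
  qed (use assms in auto)
  then have "bernoulli_sum p F (\<lambda>A. of_bool (real (card A) \<le> c)) \<le>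
      bernoulli_sum p F (\<lambda>A. s ^ card A * s powr (- c))"
    using assms by (intro bernoulli_sum_mono)
  then show ?thesis
    using assms by (simp add: bernoulli_sum_mult_right bernoulli_sum_power_card)
qed

lemma bernoulli_sum_card_le_0:
  assumes "finite F"
  shows "bernoulli_sum p F (\<lambda>A. of_bool (real (card A) \<le> 0)) = (1 - p) ^ card F"
proof -
  have "bernoulli_sum p F (\<lambda>A. of_bool (real (card A) \<le> 0)) = bernoulli_sum p F (\<lambda>A. 0 ^ card A)"
    unfolding bernoulli_sum_def
    by (intro sum.cong refl) (simp add: power_0_left of_bool_def)
  then show ?thesis
    using assms by (simp add: bernoulli_sum_power_card)
qed

lemma thin_event_0_imp_open_cluster:
  assumes "simple_graph G" "x \<in> S" "S \<subseteq> verts G" "\<omega> \<in> thin_event G 0 S"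
    and fin: "finite (edge_boundary G S)"
  shows "verts (open_cluster G \<omega> x) = S"
proof -
  let ?R = "adjacency (open_subgraph G \<omega>)"
  have conn: "connected_graph \<lparr>verts = S, edges = {e \<in> internal_edges G S. \<omega> e}\<rparr>"
    and closed: "{e \<in> edge_boundary G S. \<omega> e} = {}"
    using assms(4) fin by (auto simp: thin_event_def)
  have "adjacency \<lparr>verts = S, edges = {e \<in> internal_edges G S. \<omega> e}\<rparr> \<subseteq> ?R"
    by (auto simp: internal_edges_def open_subgraph_def)
  from rtrancl_mono[OF this] have "(x, v) \<in> ?R\<^sup>*" if "v \<in> S" for v
    using conn assms(2) that unfolding connected_graph_def graph.select_convs by blast
  moreover have "v \<in> S" if "(x, v) \<in> ?R\<^sup>*" for v
    using that
  proof (induction rule: rtrancl_induct)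
    case (step u v)
    then have "{u, v} \<in> edges G" "\<omega> {u, v}"
      by (auto simp: open_subgraph_def)
    moreover from this have "v \<in> verts G"
      using assms(1) by (auto simp: simple_graph_def)
    ultimately show ?case
      using closed step.IH by (auto simp: edge_boundary_def)
  qed (use assms in simp)
  ultimately show ?thesis
    using assms(3) by (auto simp: open_cluster_def induced_subgraph_def)
qed

text \<open>The strict inequality \<open>ln u < u - 1\<close> at \<open>u = p / p'\<close> has the gap \<open>\<delta>\<close>; half of it pays for \<open>s\<close>
  and half of it for \<open>\<epsilon>\<close>. The choice \<open>p' = 1 / (1 + h)\<close> is what makes the first-order terms of
  \<open>ln (p / p')\<close> and \<open>h * ln ((1 - p) / (1 - p'))\<close> cancel. Replacing \<open>1 - p\<close> by \<open>1 - p + p * s > 0\<close>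
  also keeps the logarithm meaningful when \<open>p = 1\<close>.\<close>

lemma percolation_constants:
  fixes h p p' :: real
  assumes "0 < h" "p' = 1 / (1 + h)" "p' < p" "p \<le> 1"
  shows "\<exists>s \<epsilon>. 0 < s \<and> s \<le> 1 \<and> 0 < \<epsilon> \<and> (\<forall>n b :: nat. h * n \<le> b \<longrightarrow>
    (p / p') ^ n * ((1 - p + p * s) ^ b * s powr (- (\<epsilon> * n))) \<le> (1 - p') ^ b)"
proof -
  have p': "0 < p'" "p' < 1" "1 - p' = h * p'"
    unfolding assms(2) using assms(1) by (auto simp: field_simps)
  have "0 < p"
    using p'(1) assms(3) by (rule less_trans)
  have ratio: "1 < p / p'"
    using p'(1) assms(3) by simp
  define \<delta> where "\<delta> = p / p' - 1 - ln (p / p')"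
  have "0 < \<delta>"
    using ln_le_minus_one[of "p / p'"] ln_eq_minus_one[of "p / p'"] ratio by (force simp: \<delta>_def)
  define s where "s = min (1/2) (min ((p - p') / p) (p' * \<delta> / (2 * p)))"
  have s: "0 < s" "s < 1"
    using \<open>0 < \<delta>\<close> \<open>0 < p\<close> p'(1) assms(3) by (simp_all add: s_def)
  have "s \<le> (p - p') / p" "s \<le> p' * \<delta> / (2 * p)"
    by (auto simp: s_def)
  then have s_le: "p * s \<le> p - p'" "p * s \<le> p' * \<delta> / 2"
    using \<open>0 < p\<close> by (auto simp: field_simps)
  define \<epsilon> where "\<epsilon> = \<delta> / (2 * - ln s)"
  have "ln s < 0"
    using s by simp
  then have \<epsilon>: "0 < \<epsilon>" "\<epsilon> * ln s = - \<delta> / 2"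
    using \<open>0 < \<delta>\<close> by (auto simp: \<epsilon>_def field_simps)
  define t where "t = 1 - p + p * s"
  have t: "0 < t" "t \<le> 1 - p'"
    using s_le assms(4) \<open>0 < p\<close> s by (auto simp: t_def intro: add_nonneg_pos)
  define L where "L = ln (t / (1 - p'))"
  have "L \<le> 0"
    unfolding L_def using t p' by (subst ln_le_zero_iff) auto
  have "h * L \<le> h * (t / (1 - p') - 1)"
    unfolding L_def using t p' assms(1) by (intro mult_left_mono ln_le_minus_one) auto
  also have "\<dots> = (t - (1 - p')) / p'"
    unfolding p'(3) using p'(1) assms(1) by (simp add: field_simps)
  also have "\<dots> \<le> 1 - p / p' + \<delta> / 2"
    using s_le(2) p' by (simp add: t_def field_simps)
  finally have key: "ln (p / p') - \<epsilon> * ln s + h * L \<le> 0"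
    using \<epsilon>(2) \<delta>_def by linarith
  have "(p / p') ^ n * (t ^ b * s powr (- (\<epsilon> * n))) \<le> (1 - p') ^ b" if "h * n \<le> b" for n b :: nat
  proof -
    have "(p / p') ^ n = exp (n * ln (p / p'))" "t ^ b = exp (b * ln t)"
      "s powr (- (\<epsilon> * n)) = exp (- (\<epsilon> * n) * ln s)" "(1 - p') ^ b = exp (b * ln (1 - p'))"
      using ratio t s p' by (auto simp: exp_of_nat_mult powr_def)
    moreover have "n * ln (p / p') + (b * ln t + - (\<epsilon> * n) * ln s) \<le> b * ln (1 - p')"
    proof -
      have "b * L \<le> (h * n) * L"
        using that \<open>L \<le> 0\<close> by (rule mult_right_mono_neg)
      moreover have "n * (ln (p / p') - \<epsilon> * ln s + h * L) \<le> 0"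
        using key by (intro mult_nonneg_nonpos) auto
      moreover have "ln t = L + ln (1 - p')"
        using t p' assms(1) by (simp add: L_def ln_div)
      ultimately show ?thesis
        by (simp add: algebra_simps)
    qed
    ultimately show ?thesis
      by (simp flip: exp_add)
  qed
  then show ?thesis
    using s \<epsilon> by (intro exI[of _ s] exI[of _ \<epsilon>]) (auto simp: t_def)
qed

text \<open>The probability at \<open>p\<close> that \<open>S\<close> is connected inside with few open boundary edges is at most
  the probability at \<open>p'\<close> that \<open>S\<close> is an open cluster.\<close>

lemma measure_thin_event_le:
  fixes p p' s \<epsilon> :: real
  assumes G: "locally_finite_graph G" and S: "finite S" "S \<subseteq> verts G"
    and p: "0 < p'" "p' \<le> p" "p \<le> 1" and s: "0 < s" "s \<le> 1"
    and bound: "(p / p') ^ card S * ((1 - p + p * s) ^ card (edge_boundary G S) *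
      s powr (- (\<epsilon> * card S))) \<le> (1 - p') ^ card (edge_boundary G S)"
  shows "measure (bernoulli_percolation G p) (thin_event G \<epsilon> S) \<le>
    measure (bernoulli_percolation G p') (thin_event G 0 S)"
proof -
  let ?I = "internal_edges G S" and ?J = "edge_boundary G S" and ?n = "card S"
  let ?P = "\<lambda>A. connected_graph \<lparr>verts = S, edges = A\<rparr>"
  let ?q = "\<lambda>p. bernoulli_sum p ?I (\<lambda>A. of_bool (?P A))"
  let ?c = "(1 - p + p * s) ^ card ?J * s powr (- (\<epsilon> * ?n))"
  have fin: "finite ?I" "finite ?J"
    using G S by (auto intro: finite_internal_edges finite_edge_boundary)
  have c: "0 \<le> ?c"
    using p s by (intro mult_nonneg_nonneg zero_le_power add_nonneg_nonneg) auto
  have q: "0 \<le> ?q p'"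
    using p by (intro bernoulli_sum_nonneg) auto
  have "(p' / p) ^ ?n * ?q p \<le> ?q (p * (p' / p))"
  proof (rule bernoulli_sum_increasing_compare)
    show "?P B" if "?P A" "A \<subseteq> B" for A B
      using that by (rule connected_graph_mono)
    show "\<exists>T\<subseteq>A. card T \<le> ?n \<and> ?P T" if "A \<subseteq> ?I" "?P A" for A
    proof (rule connected_graph_spanning_subset)
      show "A \<subseteq> Pow S"
        using that by (auto simp: internal_edges_def)
    qed (use that S in auto)
  qed (use fin p in auto)
  then have "?q p \<le> (p / p') ^ ?n * ?q p'"
    using p by (simp add: field_simps)
  then have "?q p * ?c \<le> (p / p') ^ ?n * ?q p' * ?c"
    using c by (rule mult_right_mono)
  also have "\<dots> = ?q p' * ((p / p') ^ ?n * ?c)"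
    by (simp only: mult_ac)
  also have "\<dots> \<le> ?q p' * (1 - p') ^ card ?J"
    using bound q by (rule mult_left_mono)
  also have "\<dots> = measure (bernoulli_percolation G p') (thin_event G 0 S)"
    using G S p fin bernoulli_sum_card_le_0[of ?J p'] by (subst measure_thin_event) auto
  finally have le: "?q p * ?c \<le> measure (bernoulli_percolation G p') (thin_event G 0 S)" .
  have "measure (bernoulli_percolation G p) (thin_event G \<epsilon> S) =
      ?q p * bernoulli_sum p ?J (\<lambda>A. of_bool (real (card A) \<le> \<epsilon> * ?n))"
    using G S p by (subst measure_thin_event) auto
  also have "\<dots> \<le> ?q p * ?c"
    using fin p s by (intro mult_left_mono bernoulli_sum_card_le bernoulli_sum_nonneg) auto
  also note le
  finally show ?thesis .
qed

text \<open>The events are disjoint, since each of them determines the open cluster of \<open>x\<close>.\<close>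

lemma sum_measure_thin_event_0_le:
  assumes "simple_graph G" "locally_finite_graph G" "0 \<le> p" "p \<le> 1" "finite T"
    and T: "\<And>S. S \<in> T \<Longrightarrow> finite S \<and> x \<in> S \<and> S \<subseteq> verts G"
  shows "(\<Sum>S\<in>T. measure (bernoulli_percolation G p) (thin_event G 0 S)) \<le> 1"
proof -
  interpret prob_space "bernoulli_percolation G p"
    by (rule prob_space_bernoulli_percolation)
  have cluster: "verts (open_cluster G \<omega> x) = S" if "S \<in> T" "\<omega> \<in> thin_event G 0 S" for S \<omega>
    using that assms by (intro thin_event_0_imp_open_cluster finite_edge_boundary) auto
  have "(\<Sum>S\<in>T. prob (thin_event G 0 S)) = prob (\<Union>S\<in>T. thin_event G 0 S)"
  proof (rule finite_measure_finite_Union[symmetric])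
    show "disjoint_family_on (thin_event G 0) T"
      unfolding disjoint_family_on_def using cluster by blast
    show "thin_event G 0 ` T \<subseteq> events"
      using assms by (auto intro!: thin_event_sets)
  qed fact
  then show ?thesis
    by simp
qed

text \<open>The Borel--Cantelli lemma over a countable index set, with a bound on finite partial sums in
  place of summability.\<close>

lemma AE_finite_of_bounded_sum:
  assumes "finite_measure M" "countable I" "\<And>i. i \<in> I \<Longrightarrow> A i \<in> sets M"
    and bound: "\<And>T. finite T \<Longrightarrow> T \<subseteq> I \<Longrightarrow> (\<Sum>i\<in>T. measure M (A i)) \<le> c"
  shows "AE \<omega> in M. finite {i \<in> I. \<omega> \<in> A i}"
proof -
  interpret finite_measure M
    by fact
  define f where "f = to_nat_on I"
  define g where "g = the_inv_into I f"
  have inj: "inj_on f I"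
    unfolding f_def using assms(2) by (rule inj_on_to_nat_on)
  have gf: "g (f i) = i" if "i \<in> I" for i
    unfolding g_def using inj that by (rule the_inv_into_f_f)
  define B where "B n = (if n \<in> f ` I then A (g n) else {})" for n
  have B_sets: "B n \<in> sets M" for n
    using assms(3) gf by (auto simp: B_def)
  have "summable (\<lambda>n. measure M (B n))"
  proof (rule bounded_imp_summable[where B = c])
    fix n
    have "(\<Sum>k\<le>n. measure M (B k)) = (\<Sum>k\<in>{..n} \<inter> f ` I. measure M (A (g k)))"
      by (intro sum.mono_neutral_cong_right) (auto simp: B_def)
    also have "\<dots> = (\<Sum>i\<in>g ` ({..n} \<inter> f ` I). measure M (A i))"
      by (subst sum.reindex) (auto simp: inj_on_def gf)
    also have "\<dots> \<le> c"
      by (rule bound) (auto simp: gf)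
    finally show "(\<Sum>k\<le>n. measure M (B k)) \<le> c" .
  qed simp
  then have "AE \<omega> in M. eventually (\<lambda>n. \<omega> \<in> space M - B n) sequentially"
    using B_sets by (intro borel_cantelli_AE1) (auto simp: less_top[symmetric])
  then show ?thesis
  proof eventually_elim
    fix \<omega> assume "eventually (\<lambda>n. \<omega> \<in> space M - B n) sequentially"
    then obtain N where N: "\<And>n. n \<ge> N \<Longrightarrow> \<omega> \<notin> B n"
      by (auto simp: eventually_sequentially)
    have "{i \<in> I. \<omega> \<in> A i} \<subseteq> g ` {..<N}"
    proof
      fix i assume i: "i \<in> {i \<in> I. \<omega> \<in> A i}"
      then have "\<omega> \<in> B (f i)"
        by (auto simp: B_def gf)
      then have "f i < N"
        using N not_less by blast
      then show "i \<in> g ` {..<N}"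
        using i gf by (intro image_eqI[of _ _ "f i"]) auto
    qed
    then show "finite {i \<in> I. \<omega> \<in> A i}"
      by (rule finite_subset) simp
  qed
qed

section \<open>Anchored expansion of an open cluster\<close>

lemma edge_boundary_open_cluster:
  assumes "S \<subseteq> verts (open_cluster G \<omega> x)"
  shows "edge_boundary (open_cluster G \<omega> x) S = {e \<in> edge_boundary G S. \<omega> e}"
proof -
  let ?R = "adjacency (open_subgraph G \<omega>)"
  have S: "u \<in> verts G" "(x, u) \<in> ?R\<^sup>*" if "u \<in> S" for u
    using assms that by (auto simp: open_cluster_def induced_subgraph_def)
  have "(x, v) \<in> ?R\<^sup>*" if "u \<in> S" "{u, v} \<in> edges G" "\<omega> {u, v}" for u v
    using S(2)[OF that(1)] by (rule rtrancl_into_rtrancl) (use that in \<open>simp add: open_subgraph_def\<close>)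
  then show ?thesis
    using S by (fastforce simp: edge_boundary_def open_cluster_def induced_subgraph_def open_subgraph_def)
qed

lemma induced_subgraph_open_cluster:
  assumes "S \<subseteq> verts (open_cluster G \<omega> x)"
  shows "induced_subgraph (open_cluster G \<omega> x) S =
    \<lparr>verts = S, edges = {e \<in> internal_edges G S. \<omega> e}\<rparr>"
  using assms
  by (auto simp: induced_subgraph_def open_cluster_def open_subgraph_def internal_edges_def)

lemma anchored_sets_open_cluster:
  assumes "S \<in> anchored_sets (open_cluster G \<omega> x) x n"
  shows "S \<in> anchored_sets G x n"
    and "connected_graph \<lparr>verts = S, edges = {e \<in> internal_edges G S. \<omega> e}\<rparr>"
proof -
  have S: "S \<subseteq> verts (open_cluster G \<omega> x)"
    using assms by (simp add: anchored_sets_def)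
  show conn: "connected_graph \<lparr>verts = S, edges = {e \<in> internal_edges G S. \<omega> e}\<rparr>"
    using assms by (simp add: anchored_sets_def flip: induced_subgraph_open_cluster[OF S])
  have "connected_graph (induced_subgraph G S)"
    unfolding induced_subgraph_def
    by (rule connected_graph_mono[OF conn]) (auto simp: internal_edges_def)
  moreover have "S \<subseteq> verts G"
    using S by (auto simp: open_cluster_def induced_subgraph_def)
  ultimately show "S \<in> anchored_sets G x n"
    using assms by (simp add: anchored_sets_def)
qed

lemma anchored_expansion_open_cluster_ge:
  assumes "\<omega> \<in> (\<Pi>\<^sub>E e\<in>edges G. UNIV)" "finite {S \<in> anchored_sets G x N. \<omega> \<in> thin_event G \<epsilon> S}"
  shows "anchored_expansion (open_cluster G \<omega> x) x \<ge> ereal \<epsilon>"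
proof -
  let ?H = "open_cluster G \<omega> x"
  obtain K where K: "\<And>S. S \<in> anchored_sets G x N \<Longrightarrow> \<omega> \<in> thin_event G \<epsilon> S \<Longrightarrow> card S < K"
  proof -
    have "finite (card ` {S \<in> anchored_sets G x N. \<omega> \<in> thin_event G \<epsilon> S})"
      using assms(2) by simp
    then obtain K where "\<forall>k\<in>card ` {S \<in> anchored_sets G x N. \<omega> \<in> thin_event G \<epsilon> S}. k < K"
      unfolding finite_nat_set_iff_bounded by blast
    then show ?thesis
      by (intro that) auto
  qed
  have "ereal \<epsilon> \<le> (INF S\<in>anchored_sets ?H x n. ereal (real (card (edge_boundary ?H S)) / real (card S)))"
    if n: "n \<ge> max N K" for n
  proof (rule INF_greatest)
    fix S assume S: "S \<in> anchored_sets ?H x n"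
    have card_S: "0 < card S" "max N K \<le> card S"
      using S n by (auto simp: anchored_sets_def card_gt_0_iff)
    have "S \<in> anchored_sets G x N"
      using anchored_sets_open_cluster(1)[OF S] n by (auto simp: anchored_sets_def)
    with K card_S have "\<omega> \<notin> thin_event G \<epsilon> S"
      by (meson max.boundedE not_less)
    then have "\<epsilon> * real (card S) < real (card {e \<in> edge_boundary G S. \<omega> e})"
      using assms(1) anchored_sets_open_cluster(2)[OF S] by (auto simp: thin_event_def)
    moreover have "edge_boundary ?H S = {e \<in> edge_boundary G S. \<omega> e}"
      using S by (intro edge_boundary_open_cluster) (auto simp: anchored_sets_def)
    ultimately show "ereal \<epsilon> \<le> ereal (real (card (edge_boundary ?H S)) / real (card S))"
      using card_S by (simp add: field_simps)
  qed
  then show ?thesis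
    by (intro LIMSEQ_le_const[OF anchored_expansion_LIMSEQ]) blast
qed

lemma isoperimetric_constant_below:
  fixes p :: real and a :: ereal
  assumes "0 < a" "0 \<le> p" "p \<le> 1" "ereal p > 1 / (1 + a)"
  shows "\<exists>h. 0 < h \<and> ereal h < a \<and> 1 / (1 + h) < p"
proof (cases a)
  case (real r)
  then have r: "0 < r" "1 / (1 + r) < p"
    using assms by (auto simp: one_ereal_def)
  then have "0 < p"
    by (smt (verit) divide_nonneg_nonneg)
  then have "max 0 (1 / p - 1) < r"
    using r by (simp add: field_simps)
  then obtain h where h: "max 0 (1 / p - 1) < h" "h < r"
    using dense by blast
  then have "1 / (1 + h) < p"
    using \<open>0 < p\<close> by (simp add: field_simps)
  then show ?thesis
    using h real by (intro exI[of _ h]) auto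
next
  case PInf
  then have "0 < p"
    using assms by simp
  then show ?thesis
    using assms PInf by (intro exI[of _ "1 / p"]) (auto simp: field_simps)
qed (use assms in auto)

theorem theoremA1:
  fixes G :: "'v graph" and x :: 'v and p :: real
  assumes "simple_graph G"
    and "infinite (verts G)"
    and "connected_graph G"
    and "locally_finite_graph G"
    and "x \<in> verts G"
    and "anchored_expansion G x > 0"
    and "0 \<le> p" and "p \<le> 1"
    and "ereal p > 1 / (1 + anchored_expansion G x)"
  shows "AE \<omega> in bernoulli_percolation G p.
           infinite (verts (open_cluster G \<omega> x)) \<longrightarrow>
             anchored_expansion (open_cluster G \<omega> x) x > 0"
proof -
  let ?M = "bernoulli_percolation G"
  obtain h where h: "0 < h" "ereal h < anchored_expansion G x" "1 / (1 + h) < p"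
    using isoperimetric_constant_below[OF assms(6-9)] by blast
  define p' where "p' = 1 / (1 + h)"
  have p': "0 < p'" "p' < p" "p' \<le> 1"
    using h assms(8) by (auto simp: p'_def)
  obtain s \<epsilon> where s: "0 < s" "s \<le> 1" and "0 < \<epsilon>"
    and bound: "\<And>n b :: nat. h * n \<le> b \<Longrightarrow>
      (p / p') ^ n * ((1 - p + p * s) ^ b * s powr (- (\<epsilon> * n))) \<le> (1 - p') ^ b"
    using percolation_constants[OF h(1) p'_def p'(2) assms(8)] by blast
  obtain N where N: "ereal h <
      (INF S\<in>anchored_sets G x N. ereal (real (card (edge_boundary G S)) / real (card S)))"
    using order_tendstoD(1)[OF anchored_expansion_LIMSEQ h(2)]
    by (auto simp: eventually_sequentially)
  let ?A = "anchored_sets G x N"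
  have A: "finite S \<and> x \<in> S \<and> S \<subseteq> verts G" if "S \<in> ?A" for S
    using that by (auto simp: anchored_sets_def)
  have expand: "h * card S \<le> card (edge_boundary G S)" if S: "S \<in> ?A" for S
  proof -
    have "ereal h < ereal (real (card (edge_boundary G S)) / real (card S))"
      using N S by (rule less_INF_D)
    moreover have "0 < card S"
      using A[OF S] by (auto simp: card_gt_0_iff)
    ultimately show ?thesis
      by (simp add: field_simps)
  qed
  have le: "measure (?M p) (thin_event G \<epsilon> S) \<le> measure (?M p') (thin_event G 0 S)" if "S \<in> ?A" for S
    using A[OF that] s p' assms(4,8) bound[OF expand[OF that]]
    by (intro measure_thin_event_le[where s = s]) auto
  have "AE \<omega> in ?M p. finite {S \<in> ?A. \<omega> \<in> thin_event G \<epsilon> S}"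
  proof (rule AE_finite_of_bounded_sum)
    show "finite_measure (?M p)"
      using prob_space_bernoulli_percolation by (rule prob_space.finite_measure)
    show "countable ?A"
      by (rule countable_subset[OF _ countable_Collect_finite_subset[OF countable_verts[OF assms(1,3,4)]]])
        (use A in auto)
    show "thin_event G \<epsilon> S \<in> sets (?M p)" if "S \<in> ?A" for S
      using A[OF that] assms(4,7,8) by (intro thin_event_sets) auto
    show "(\<Sum>S\<in>T. measure (?M p) (thin_event G \<epsilon> S)) \<le> 1" if T: "finite T" "T \<subseteq> ?A" for T
    proof -
      have "(\<Sum>S\<in>T. measure (?M p) (thin_event G \<epsilon> S)) \<le>
          (\<Sum>S\<in>T. measure (?M p') (thin_event G 0 S))"
        using T le by (intro sum_mono) auto
      also have "\<dots> \<le> 1"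
        using T A p' assms(1,4) by (intro sum_measure_thin_event_0_le[where x = x]) auto
      finally show ?thesis .
    qed
  qed
  moreover have "AE \<omega> in ?M p. \<omega> \<in> (\<Pi>\<^sub>E e\<in>edges G. UNIV)"
    using AE_space[of "?M p"] by (simp only: space_bernoulli_percolation)
  ultimately show ?thesis
  proof eventually_elim
    case (elim \<omega>)
    have "ereal \<epsilon> \<le> anchored_expansion (open_cluster G \<omega> x) x"
      using elim by (intro anchored_expansion_open_cluster_ge) auto
    then show ?case
      using \<open>0 < \<epsilon>\<close> by (metis less_le_trans ereal_less(2))
  qed
qed

end
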